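(* Let $\tau_{\mathrm{L}}$, $\tau_{*}$ and $\tau_{\wedge}$ denote the open ball topologies on $(\mathbb{E}^1,S)$ induced by the {\L}ukasiewicz, product and G\"odel t-norms, respectively. Then $$\tau_{\mathrm{L}}\subseteq\tau_{*}\subseteq\tau_{\wedge}.$$
   Context: For a t-norm $\&$ on $[0,1]$, the residuated implication is $x\rightarrow y=\sup\{w\in[0,1] : x\,\&\,w\le y\}$. The three t-norms are: {\L}ukasiewicz, $a\,\&\,b=\max(a+b-1,0)$, with $a\rightarrow c=\min(1,1-a+c)$; product, $a\,\&\,b=ab$, with $a\rightarrow c=c/a$ if $a>c$ and $1$ otherwise; G\"odel (minimum), $a\,\&\,b=\min(a,b)$, with $a\rightarrow c=c$ if $a>c$ and $1$ otherwise. Fuzzy numbers: $\mathbb{E}^1$ is the set of all $u:\mathbb{R}\to[0,1]$ such that (1) $u(x_0)=1$ for some $x_0$; (2) $u(\lambda x+(1-\lambda)y)\ge\min\{u(x),u(y)\}$ for all $x,y\in\mathbb{R}$, $\lambda\in[0,1]$; (3) $u$ is upper semicontinuous; (4) $[u]_0=\overline{\{x: u(x)>0\}}$ is compact. Write $[u]_0=[u_0^-,u_0^+]$ and $[u]_1=\{x:u(x)=1\}=[u_1^-,u_1^+]$. The left part $u^\ell$ and right part $u^r$ are functions $\mathbb{R}\to[0,1]$: $u^\ell(x)=0$ for $x<u_0^-$, $u^\ell(x)=u(x)$ for $x\in[u_0^-,u_1^-]$, $u^\ell(x)=1$ for $x>u_1^-$; and $u^r(x)=1$ for $x<u_1^-$,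 $u^r(x)=u(x)$ for $x\in[u_1^-,u_0^+]$, $u^r(x)=0$ for $x>u_0^+$. For each t-norm $\&$ and $u,v\in\mathbb{E}^1$: $P(u,v)=\inf_{x\in\mathbb{R}}\left[(v^\ell(x)\rightarrow u^\ell(x))\wedge(u^r(x)\rightarrow v^r(x))\right]$ and $S(u,v)=P(u,v)\wedge P(v,u)$, with $\rightarrow$ the residuated implication of $\&$. The open ball topology on $(\mathbb{E}^1,S)$ induced by $\&$ is the topology on the set $\mathbb{E}^1$ with base $\{B(u,r): u\in\mathbb{E}^1,\ r<1\}$, where $B(u,r)=\{v\in\mathbb{E}^1: S(u,v)>r\}$. *)

theory Defs
  imports "HOL-Analysis.Analysis"
begin

definition lukasiewicz_tnorm :: "real \<Rightarrow> real \<Rightarrow> real"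
  where "lukasiewicz_tnorm a b = max (a + b - 1) 0"

definition product_tnorm :: "real \<Rightarrow> real \<Rightarrow> real"
  where "product_tnorm a b = a * b"

definition goedel_tnorm :: "real \<Rightarrow> real \<Rightarrow> real"
  where "goedel_tnorm a b = min a b"

definition residuum :: "(real \<Rightarrow> real \<Rightarrow> real) \<Rightarrow> real \<Rightarrow> real \<Rightarrow> real"
  where "residuum T x y = Sup {w \<in> {0..1}. T x w \<le> y}"

definition upper_semicontinuous :: "(real \<Rightarrow> real) \<Rightarrow> bool"
  where "upper_semicontinuous u \<longleftrightarrow> (\<forall>x. \<forall>c > u x. \<forall>\<^sub>F z in nhds x. u z < c)"

definition level0 :: "(real \<Rightarrow> real) \<Rightarrow> real set"
  where "level0 u = closure {x. u x > 0}"

definition level1 :: "(real \<Rightarrow> real) \<Rightarrow> real set"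
  where "level1 u = {x. u x = 1}"

definition fuzzy_numbers :: "(real \<Rightarrow> real) set"
  where "fuzzy_numbers = {u. range u \<subseteq> {0..1} \<and>
    (\<exists>x0. u x0 = 1) \<and>
    (\<forall>x y. \<forall>l \<in> {0..1}. u (l * x + (1 - l) * y) \<ge> min (u x) (u y)) \<and>
    upper_semicontinuous u \<and>
    compact (level0 u)}"

text \<open>For a fuzzy number, both level sets are nonempty compact intervals, so \<^term>\<open>Inf\<close> and
  \<^term>\<open>Sup\<close> give their endpoints.\<close>

definition left_part :: "(real \<Rightarrow> real) \<Rightarrow> real \<Rightarrow> real"
  where "left_part u x =
    (if x < Inf (level0 u) then 0 else if x \<le> Inf (level1 u) then u x else 1)"

definition right_part :: "(real \<Rightarrow> real) \<Rightarrow> real \<Rightarrow> real"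
  where "right_part u x =
    (if x < Inf (level1 u) then 1 else if x \<le> Sup (level0 u) then u x else 0)"

definition fuzzy_P :: "(real \<Rightarrow> real \<Rightarrow> real) \<Rightarrow> (real \<Rightarrow> real) \<Rightarrow> (real \<Rightarrow> real) \<Rightarrow> real"
  where "fuzzy_P T u v = (INF x. min (residuum T (left_part v x) (left_part u x))
                               (residuum T (right_part u x) (right_part v x)))"

definition fuzzy_S :: "(real \<Rightarrow> real \<Rightarrow> real) \<Rightarrow> (real \<Rightarrow> real) \<Rightarrow> (real \<Rightarrow> real) \<Rightarrow> real"
  where "fuzzy_S T u v = min (fuzzy_P T u v) (fuzzy_P T v u)"

definition fuzzy_ball ::
    "(real \<Rightarrow> real \<Rightarrow> real) \<Rightarrow> (real \<Rightarrow> real) \<Rightarrow> real \<Rightarrow> (real \<Rightarrow> real) set"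
  where "fuzzy_ball T u r = {v \<in> fuzzy_numbers. fuzzy_S T u v > r}"

definition fuzzy_balls :: "(real \<Rightarrow> real \<Rightarrow> real) \<Rightarrow> (real \<Rightarrow> real) set set"
  where "fuzzy_balls T = {fuzzy_ball T u r | u r. u \<in> fuzzy_numbers \<and> r < 1}"

definition open_ball_topology :: "(real \<Rightarrow> real \<Rightarrow> real) \<Rightarrow> (real \<Rightarrow> real) topology"
  where "open_ball_topology T = topology (arbitrary union_of (\<lambda>B. B \<in> fuzzy_balls T))"

text \<open>The balls really form a base of a topology on the set of fuzzy numbers whenever the t-norm is
  continuous, so that the partially specified \<^const>\<open>topology\<close> is meaningful here.\<close>

definition continuous_tnorm :: "(real \<Rightarrow> real \<Rightarrow> real) \<Rightarrow> bool"
  where "continuous_tnorm T \<longleftrightarrow>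
    (\<forall>a\<in>{0..1}. \<forall>b\<in>{0..1}. T a b \<in> {0..1} \<and> T a b = T b a \<and>
       (\<forall>c\<in>{0..1}. T (T a b) c = T a (T b c) \<and> (b \<le> c \<longrightarrow> T a b \<le> T a c))) \<and>
    (\<forall>a\<in>{0..1}. T a 1 = a \<and> continuous_on {0..1} (T a))"

lemma continuous_tnormI:
  assumes "\<And>a b. \<lbrakk>a \<in> {0..1}; b \<in> {0..1}\<rbrakk> \<Longrightarrow> T a b \<in> {0..1}"
    and "\<And>a b. T a b = T b a"
    and "\<And>a b c. \<lbrakk>a \<in> {0..1}; b \<in> {0..1}; c \<in> {0..1}\<rbrakk> \<Longrightarrow> T (T a b) c = T a (T b c)"
    and "\<And>a b c. \<lbrakk>a \<in> {0..1}; b \<le> c\<rbrakk> \<Longrightarrow> T a b \<le> T a c"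
    and "\<And>a. a \<in> {0..1} \<Longrightarrow> T a 1 = a"
    and "\<And>a. continuous_on {0..1} (T a)"
  shows "continuous_tnorm T"
  unfolding continuous_tnorm_def using assms by blast

lemma continuous_lukasiewicz: "continuous_tnorm lukasiewicz_tnorm"
proof (rule continuous_tnormI)
  show "continuous_on {0..1} (lukasiewicz_tnorm a)" for a
    unfolding lukasiewicz_tnorm_def by (intro continuous_intros)
qed (simp_all add: lukasiewicz_tnorm_def max_def)

lemma continuous_product: "continuous_tnorm product_tnorm"
proof (rule continuous_tnormI)
  show "continuous_on {0..1} (product_tnorm a)" for a
    unfolding product_tnorm_def by (intro continuous_intros)
qed (simp_all add: product_tnorm_def mult_le_one mult_left_mono)

lemma continuous_goedel: "continuous_tnorm goedel_tnorm"
proof (rule continuous_tnormI)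
  show "continuous_on {0..1} (goedel_tnorm a)" for a
    unfolding goedel_tnorm_def by (intro continuous_intros)
qed (simp_all add: goedel_tnorm_def min_def)

lemma residuum_lukasiewicz:
  assumes "a \<in> {0..1}" "c \<in> {0..1}"
  shows "residuum lukasiewicz_tnorm a c = min 1 (1 - a + c)"
proof -
  have "{w \<in> {0..1}. lukasiewicz_tnorm a w \<le> c} = {0..min 1 (1 - a + c)}"
    using assms by (auto simp: lukasiewicz_tnorm_def)
  then show ?thesis
    using assms by (simp add: residuum_def)
qed

lemma residuum_product:
  assumes "a \<in> {0..1}" "c \<in> {0..1}"
  shows "residuum product_tnorm a c = (if a > c then c / a else 1)"
proof -
  have "product_tnorm a w \<le> c \<longleftrightarrow> w \<le> (if a > c then c / a else 1)"
    if w: "w \<in> {0..1}" for w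
  proof (cases "a > c")
    case True
    then show ?thesis
      using assms by (simp add: product_tnorm_def pos_le_divide_eq mult.commute)
  next
    case False
    have "a * w \<le> a * 1" by (rule mult_left_mono) (use w assms in auto)
    then show ?thesis using False w by (simp add: product_tnorm_def)
  qed
  moreover have "(if a > c then c / a else 1) \<in> {0..1}"
    using assms by simp
  ultimately have "{w \<in> {0..1}. product_tnorm a w \<le> c} = {0..if a > c then c / a else 1}"
    by auto
  then show ?thesis
    using assms by (simp add: residuum_def)
qed

lemma residuum_goedel:
  assumes "a \<in> {0..1}" "c \<in> {0..1}"
  shows "residuum goedel_tnorm a c = (if a > c then c else 1)"
proof -
  have "{w \<in> {0..1}. goedel_tnorm a w \<le> c} = {0..if a > c then c else 1}"
    using assms by (auto simp: goedel_tnorm_def)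
  then show ?thesis
    using assms by (simp add: residuum_def)
qed

lemma continuous_tnormD:
  assumes "continuous_tnorm T" "a \<in> {0..1}"
  shows "b \<in> {0..1} \<Longrightarrow> T a b \<in> {0..1}"
    and "b \<in> {0..1} \<Longrightarrow> T a b = T b a"
    and "b \<in> {0..1} \<Longrightarrow> c \<in> {0..1} \<Longrightarrow> T (T a b) c = T a (T b c)"
    and "b \<in> {0..1} \<Longrightarrow> c \<in> {0..1} \<Longrightarrow> b \<le> c \<Longrightarrow> T a b \<le> T a c"
    and "T a 1 = a"
    and "continuous_on {0..1} (T a)"
  using assms unfolding continuous_tnorm_def by blast+

lemma residuum_props:
  assumes T: "continuous_tnorm T" and a: "a \<in> {0..1}" and b: "b \<in> {0..1}"
  shows residuum_mem: "residuum T a b \<in> {0..1}"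
    and residuum_mp: "T a (residuum T a b) \<le> b"
    and residuum_upper: "\<And>w. w \<in> {0..1} \<Longrightarrow> T a w \<le> b \<Longrightarrow> w \<le> residuum T a b"
proof -
  let ?W = "{w \<in> {0..1}. T a w \<le> b}"
  have z: "0 \<in> ?W"
  proof -
    have "T a 0 = T 0 a" "T 0 a \<le> T 0 1" "T 0 1 = 0"
      using a by (auto intro: continuous_tnormD[OF T])
    then show ?thesis using b by auto
  qed
  have "closed ?W"
    by (intro continuous_on_closed_Collect_le continuous_tnormD(6)[OF T a] continuous_on_const
        closed_atLeastAtMost)
  moreover have bdd: "bdd_above ?W" by (rule bdd_aboveI[of _ 1]) auto
  ultimately have "Sup ?W \<in> ?W"
    using z by (metis (lifting) closed_contains_Sup empty_iff)
  then show "residuum T a b \<in> {0..1}" "T a (residuum T a b) \<le> b"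
    by (auto simp: residuum_def)
  show "w \<le> residuum T a b" if "w \<in> {0..1}" "T a w \<le> b" for w
    unfolding residuum_def using bdd that by (intro cSup_upper) auto
qed

lemma tnorm_mono2:
  assumes T: "continuous_tnorm T" and "a \<in> {0..1}" "b \<in> {0..1}" "c \<in> {0..1}" "d \<in> {0..1}"
    and "a \<le> c" "b \<le> d"
  shows "T a b \<le> T c d"
proof -
  have "T a b \<le> T a d" "T a d = T d a" "T d a \<le> T d c" "T d c = T c d"
    using assms(2-) by (auto intro!: continuous_tnormD[OF T] simp del: atLeastAtMost_iff)
  then show ?thesis by simp
qed

lemma residuum_trans:
  assumes T: "continuous_tnorm T" and a: "a \<in> {0..1}" and b: "b \<in> {0..1}" and c: "c \<in> {0..1}"
  shows "T (residuum T a b) (residuum T b c) \<le> residuum T a c"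
proof -
  let ?r = "residuum T a b" and ?s = "residuum T b c"
  note rs = residuum_mem[OF T a b] residuum_mem[OF T b c]
  note m = continuous_tnormD(1)[OF T rs] continuous_tnormD(1)[OF T a rs(1)]
  have "T a (T ?r ?s) = T (T a ?r) ?s"
    by (rule continuous_tnormD(3)[OF T a rs, symmetric])
  also have "\<dots> \<le> T b ?s"
    by (rule tnorm_mono2[OF T m(2) rs(2) b rs(2) residuum_mp[OF T a b] order.refl])
  also have "\<dots> \<le> c" by (rule residuum_mp[OF T b c])
  finally show ?thesis by (rule residuum_upper[OF T a c m(1)])
qed

lemma parts_mem:
  assumes "u \<in> fuzzy_numbers"
  shows "left_part u x \<in> {0..1}" "right_part u x \<in> {0..1}"
proof -
  have "u x \<in> {0..1}" for x using assms unfolding fuzzy_numbers_def by blast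
  then show "left_part u x \<in> {0..1}" "right_part u x \<in> {0..1}"
    by (simp_all only: left_part_def right_part_def split: if_split) simp_all
qed

lemma P_props:
  assumes T: "continuous_tnorm T" and u: "u \<in> fuzzy_numbers" and v: "v \<in> fuzzy_numbers"
  shows P_le_left: "fuzzy_P T u v \<le> residuum T (left_part v x) (left_part u x)"
    and P_le_right: "fuzzy_P T u v \<le> residuum T (right_part u x) (right_part v x)"
    and P_mem: "fuzzy_P T u v \<in> {0..1}"
proof -
  let ?f = "\<lambda>x. min (residuum T (left_part v x) (left_part u x))
                    (residuum T (right_part u x) (right_part v x))"
  have m: "?f x \<in> {0..1}" for x
    using residuum_mem[OF T parts_mem(1)[OF v, of x] parts_mem(1)[OF u, of x]]
      residuum_mem[OF T parts_mem(2)[OF u, of x] parts_mem(2)[OF v, of x]] by auto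
  then have "bdd_below (range ?f)" by (intro bdd_belowI[of _ 0]) auto
  then have le: "fuzzy_P T u v \<le> ?f x" for x
    unfolding fuzzy_P_def by (rule cINF_lower) simp
  show "fuzzy_P T u v \<le> residuum T (left_part v x) (left_part u x)"
    "fuzzy_P T u v \<le> residuum T (right_part u x) (right_part v x)"
    using le[of x] by auto
  have "0 \<le> fuzzy_P T u v"
    unfolding fuzzy_P_def by (rule cINF_greatest) (use m in auto)
  then show "fuzzy_P T u v \<in> {0..1}" using le[of 0] m[of 0] by auto
qed

lemma P_trans:
  assumes T: "continuous_tnorm T"
    and u: "u \<in> fuzzy_numbers" and v: "v \<in> fuzzy_numbers" and w: "w \<in> fuzzy_numbers"
  shows "T (fuzzy_P T u v) (fuzzy_P T v w) \<le> fuzzy_P T u w"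
proof -
  have *: "T (fuzzy_P T u v) (fuzzy_P T v w) \<le> residuum T (left_part w x) (left_part u x)" for x
  proof -
    let ?p = "residuum T (left_part v x) (left_part u x)"
      and ?q = "residuum T (left_part w x) (left_part v x)"
    have m: "?p \<in> {0..1}" "?q \<in> {0..1}"
      by (intro residuum_mem[OF T] parts_mem u v w)+
    have "T (fuzzy_P T u v) (fuzzy_P T v w) \<le> T ?p ?q"
      by (rule tnorm_mono2[OF T P_mem[OF T u v] P_mem[OF T v w] m P_le_left[OF T u v] P_le_left[OF T v w]])
    also have "\<dots> = T ?q ?p"
      by (rule continuous_tnormD(2)[OF T m])
    also have "\<dots> \<le> residuum T (left_part w x) (left_part u x)"
      by (intro residuum_trans[OF T] parts_mem u v w)
    finally show ?thesis .
  qed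
  have **: "T (fuzzy_P T u v) (fuzzy_P T v w) \<le> residuum T (right_part u x) (right_part w x)" for x
  proof -
    let ?p = "residuum T (right_part u x) (right_part v x)"
      and ?q = "residuum T (right_part v x) (right_part w x)"
    have m: "?p \<in> {0..1}" "?q \<in> {0..1}"
      by (intro residuum_mem[OF T] parts_mem u v w)+
    have "T (fuzzy_P T u v) (fuzzy_P T v w) \<le> T ?p ?q"
      by (rule tnorm_mono2[OF T P_mem[OF T u v] P_mem[OF T v w] m P_le_right[OF T u v] P_le_right[OF T v w]])
    also have "\<dots> \<le> residuum T (right_part u x) (right_part w x)"
      by (intro residuum_trans[OF T] parts_mem u v w)
    finally show ?thesis .
  qed
  show ?thesis
    unfolding fuzzy_P_def[of T u w] by (rule cINF_greatest) (use * ** in auto)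
qed

lemma S_mem:
  assumes "continuous_tnorm T" "u \<in> fuzzy_numbers" "v \<in> fuzzy_numbers"
  shows "fuzzy_S T u v \<in> {0..1}"
  using P_mem[OF assms] P_mem[OF assms(1,3,2)] by (auto simp: fuzzy_S_def)

lemma S_trans:
  assumes T: "continuous_tnorm T"
    and u: "u \<in> fuzzy_numbers" and v: "v \<in> fuzzy_numbers" and w: "w \<in> fuzzy_numbers"
  shows "T (fuzzy_S T u v) (fuzzy_S T v w) \<le> fuzzy_S T u w"
proof -
  note m = S_mem[OF T u v] S_mem[OF T v w]
  have "T (fuzzy_S T u v) (fuzzy_S T v w) \<le> T (fuzzy_P T u v) (fuzzy_P T v w)"
    by (rule tnorm_mono2[OF T m P_mem[OF T u v] P_mem[OF T v w]]) (auto simp: fuzzy_S_def)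
  moreover have "T (fuzzy_S T u v) (fuzzy_S T v w) = T (fuzzy_S T v w) (fuzzy_S T u v)"
    by (rule continuous_tnormD(2)[OF T m])
  moreover have "T (fuzzy_S T v w) (fuzzy_S T u v) \<le> T (fuzzy_P T w v) (fuzzy_P T v u)"
    by (rule tnorm_mono2[OF T m(2,1) P_mem[OF T w v] P_mem[OF T v u]]) (auto simp: fuzzy_S_def)
  ultimately show ?thesis
    using P_trans[OF T u v w] P_trans[OF T w v u] by (auto simp: fuzzy_S_def)
qed

lemma S_refl:
  assumes T: "continuous_tnorm T" and u: "u \<in> fuzzy_numbers"
  shows "fuzzy_S T u u = 1"
proof -
  have r: "residuum T a a = 1" if a: "a \<in> {0..1}" for a
  proof -
    have "T a 1 \<le> a" using continuous_tnormD(5)[OF T a] by simp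
    then have "1 \<le> residuum T a a" using residuum_upper[OF T a a, of 1] by simp
    then show ?thesis using residuum_mem[OF T a a] by auto
  qed
  show ?thesis using r parts_mem[OF u] by (simp add: fuzzy_S_def fuzzy_P_def)
qed

lemma fuzzy_ball_nested:
  assumes T: "continuous_tnorm T" and u: "u \<in> fuzzy_numbers" and v: "v \<in> fuzzy_ball T u r"
  shows "\<exists>t<1. \<forall>t'. t \<le> t' \<longrightarrow> fuzzy_ball T v t' \<subseteq> fuzzy_ball T u r"
proof -
  have vE: "v \<in> fuzzy_numbers" and s: "fuzzy_S T u v > r"
    using v by (auto simp: fuzzy_ball_def)
  note sm = S_mem[OF T u vE]
  have cont: "continuous_on {0..1} (T (fuzzy_S T u v))" and one: "T (fuzzy_S T u v) 1 = fuzzy_S T u v"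
    using continuous_tnormD(5,6)[OF T sm] by auto
  obtain d where d: "d > 0"
    and dist: "\<And>x. x \<in> {0..1} \<Longrightarrow> dist x 1 < d \<Longrightarrow>
      dist (T (fuzzy_S T u v) x) (T (fuzzy_S T u v) 1) < fuzzy_S T u v - r"
    using cont[unfolded continuous_on_iff, rule_format, of 1 "fuzzy_S T u v - r"] s by auto
  have "w \<in> fuzzy_ball T u r" if t': "1 - d \<le> t'" and w: "w \<in> fuzzy_ball T v t'" for t' w
  proof -
    have wE: "w \<in> fuzzy_numbers" and "fuzzy_S T v w > t'"
      using w by (auto simp: fuzzy_ball_def)
    then have "dist (fuzzy_S T v w) 1 < d"
      using t' S_mem[OF T vE wE] by (auto simp: dist_real_def)
    then have "T (fuzzy_S T u v) (fuzzy_S T v w) > r"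
      using dist[OF S_mem[OF T vE wE]] one by (auto simp: dist_real_def)
    then show ?thesis
      using S_trans[OF T u vE wE] wE by (auto simp: fuzzy_ball_def)
  qed
  then show ?thesis using d by (intro exI[of _ "1 - d"]) auto
qed

lemma istopology_fuzzy_balls:
  assumes T: "continuous_tnorm T"
  shows "istopology (arbitrary union_of (\<lambda>B. B \<in> fuzzy_balls T))"
  unfolding istopology_base_eq
proof (intro allI impI, elim conjE)
  fix A B assume "A \<in> fuzzy_balls T" "B \<in> fuzzy_balls T"
  then obtain a r b s where A: "A = fuzzy_ball T a r" "a \<in> fuzzy_numbers"
    and B: "B = fuzzy_ball T b s" "b \<in> fuzzy_numbers"
    by (auto simp: fuzzy_balls_def)
  show "(arbitrary union_of (\<lambda>B. B \<in> fuzzy_balls T)) (A \<inter> B)"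
    unfolding arbitrary_union_of_alt
  proof
    fix v assume v: "v \<in> A \<inter> B"
    then have vE: "v \<in> fuzzy_numbers" by (auto simp: A fuzzy_ball_def)
    obtain t1 t2 where t: "t1 < 1" "t2 < 1"
      "\<And>t'. t1 \<le> t' \<Longrightarrow> fuzzy_ball T v t' \<subseteq> A" "\<And>t'. t2 \<le> t' \<Longrightarrow> fuzzy_ball T v t' \<subseteq> B"
      using fuzzy_ball_nested[OF T A(2), of v r] fuzzy_ball_nested[OF T B(2), of v s] v
      unfolding A(1) B(1) by blast
    have "fuzzy_ball T v (max t1 t2) \<in> fuzzy_balls T"
      unfolding fuzzy_balls_def
      by (intro CollectI exI[of _ v] exI[of _ "max t1 t2"]) (use vE t in simp)
    moreover have "v \<in> fuzzy_ball T v (max t1 t2)"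
      using vE t S_refl[OF T vE] by (simp add: fuzzy_ball_def)
    ultimately show "\<exists>U. U \<in> fuzzy_balls T \<and> v \<in> U \<and> U \<subseteq> A \<inter> B"
      using t by (intro exI[of _ "fuzzy_ball T v (max t1 t2)"]) auto
  qed
qed

lemma openin_open_ball_topology:
  assumes "continuous_tnorm T"
  shows "openin (open_ball_topology T) = arbitrary union_of (\<lambda>B. B \<in> fuzzy_balls T)"
  unfolding open_ball_topology_def
  using istopology_fuzzy_balls[OF assms] by (simp add: topology_inverse')

lemma topspace_open_ball_topology:
  assumes T: "continuous_tnorm T"
  shows "topspace (open_ball_topology T) = fuzzy_numbers"
proof
  show "topspace (open_ball_topology T) \<subseteq> fuzzy_numbers"
    unfolding topspace_def openin_open_ball_topology[OF T]
    by (auto simp: union_of_def fuzzy_balls_def fuzzy_ball_def)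
  show "fuzzy_numbers \<subseteq> topspace (open_ball_topology T)"
  proof
    fix u assume u: "u \<in> fuzzy_numbers"
    have "fuzzy_ball T u 0 \<in> fuzzy_balls T"
      unfolding fuzzy_balls_def
      by (intro CollectI exI[of _ u] exI[of _ "0::real"]) (use u in simp)
    then have "openin (open_ball_topology T) (fuzzy_ball T u 0)"
      unfolding openin_open_ball_topology[OF T] by (auto intro: arbitrary_union_of_inc)
    moreover have "u \<in> fuzzy_ball T u 0"
      using u S_refl[OF T u] by (simp add: fuzzy_ball_def)
    ultimately show "u \<in> topspace (open_ball_topology T)"
      unfolding topspace_def by blast
  qed
qed

end

theory Submission
  imports Defs
begin

text \<open>Pointwise, the three t-norms are ordered: Lukasiewicz below product below minimum.
  A residuum is a supremum over the \<open>w\<close> with \<open>T x w \<le> y\<close>, so enlarging the t-norm shrinks its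
  residuum, hence also the similarity \<open>S\<close> and every ball of given centre and radius. A set that
  is open for the smaller t-norm contains, around each of its points \<open>v\<close>, a ball centred at \<open>v\<close>
  itself (this is where \<open>T\<close>-transitivity and continuity of the t-norm enter, through
  \<open>fuzzy_ball_nested\<close>); the ball of the larger t-norm with the same centre and radius
  lies inside it. So a larger t-norm induces a finer topology, and both inclusions are instances of
  this one comparison, \<open>open_ball_topology_mono\<close>.\<close>

lemma residuum_antimono:
  assumes T: "continuous_tnorm T" and T': "continuous_tnorm T'"
    and le: "\<And>a b. a \<in> {0..1} \<Longrightarrow> b \<in> {0..1} \<Longrightarrow> T a b \<le> T' a b"
    and a: "a \<in> {0..1}" and b: "b \<in> {0..1}"
  shows "residuum T' a b \<le> residuum T a b"
proof (rule residuum_upper[OF T a b])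
  show w: "residuum T' a b \<in> {0..1}"
    by (rule residuum_mem[OF T' a b])
  show "T a (residuum T' a b) \<le> b"
    using le[OF a w] residuum_mp[OF T' a b] by linarith
qed

lemma fuzzy_P_antimono:
  assumes T: "continuous_tnorm T" and T': "continuous_tnorm T'"
    and le: "\<And>a b. a \<in> {0..1} \<Longrightarrow> b \<in> {0..1} \<Longrightarrow> T a b \<le> T' a b"
    and u: "u \<in> fuzzy_numbers" and v: "v \<in> fuzzy_numbers"
  shows "fuzzy_P T' u v \<le> fuzzy_P T u v"
  unfolding fuzzy_P_def[of T]
proof (rule cINF_greatest)
  fix x :: real
  note anti = residuum_antimono[OF T T' le]
  have "fuzzy_P T' u v \<le> residuum T (left_part v x) (left_part u x)"
    by (rule order_trans[OF P_le_left[OF T' u v] anti[OF _ _ parts_mem(1)[OF v] parts_mem(1)[OF u]]])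
  moreover have "fuzzy_P T' u v \<le> residuum T (right_part u x) (right_part v x)"
    by (rule order_trans[OF P_le_right[OF T' u v] anti[OF _ _ parts_mem(2)[OF u] parts_mem(2)[OF v]]])
  ultimately show "fuzzy_P T' u v \<le> min (residuum T (left_part v x) (left_part u x))
      (residuum T (right_part u x) (right_part v x))"
    by simp
qed simp

lemma fuzzy_ball_antimono:
  assumes "continuous_tnorm T" "continuous_tnorm T'"
    and "\<And>a b. a \<in> {0..1} \<Longrightarrow> b \<in> {0..1} \<Longrightarrow> T a b \<le> T' a b"
    and u: "u \<in> fuzzy_numbers"
  shows "fuzzy_ball T' u r \<subseteq> fuzzy_ball T u r"
proof
  fix v assume "v \<in> fuzzy_ball T' u r"
  then have v: "v \<in> fuzzy_numbers" and "fuzzy_S T' u v > r"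
    by (auto simp: fuzzy_ball_def)
  moreover have "fuzzy_P T' u v \<le> fuzzy_P T u v" "fuzzy_P T' v u \<le> fuzzy_P T v u"
    by (rule fuzzy_P_antimono[OF assms(1-3)]; use u v in simp)+
  ultimately show "v \<in> fuzzy_ball T u r"
    by (auto simp: fuzzy_ball_def fuzzy_S_def)
qed

text \<open>The centre of a basic ball may differ from the point \<open>v\<close> under consideration, and
  \<open>fuzzy_ball_nested\<close> moves it to \<open>v\<close>. Balls of the two t-norms can only be compared
  when they share their centre.\<close>

lemma open_ball_topology_mono:
  assumes T: "continuous_tnorm T" and T': "continuous_tnorm T'"
    and le: "\<And>a b. a \<in> {0..1} \<Longrightarrow> b \<in> {0..1} \<Longrightarrow> T a b \<le> T' a b"
    and U: "openin (open_ball_topology T) U"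
  shows "openin (open_ball_topology T') U"
  unfolding openin_open_ball_topology[OF T'] arbitrary_union_of_alt
proof
  fix v assume "v \<in> U"
  then obtain B where "B \<in> fuzzy_balls T" and B: "v \<in> B" "B \<subseteq> U"
    using U unfolding openin_open_ball_topology[OF T] arbitrary_union_of_alt by blast
  then obtain u r where u: "u \<in> fuzzy_numbers" and B_eq: "B = fuzzy_ball T u r"
    by (auto simp: fuzzy_balls_def)
  have v: "v \<in> fuzzy_numbers"
    using B(1) by (simp add: B_eq fuzzy_ball_def)
  obtain t where t: "t < 1" "fuzzy_ball T v t \<subseteq> B"
    using fuzzy_ball_nested[OF T u, of v r] B(1) unfolding B_eq by blast
  have "fuzzy_ball T' v t \<in> fuzzy_balls T'"
    using v t(1) unfolding fuzzy_balls_def by blast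
  moreover have "v \<in> fuzzy_ball T' v t"
    using v t(1) by (simp add: fuzzy_ball_def S_refl[OF T'])
  moreover have "fuzzy_ball T' v t \<subseteq> U"
    using fuzzy_ball_antimono[OF T T' le v] t(2) B(2) by blast
  ultimately show "\<exists>W. W \<in> fuzzy_balls T' \<and> v \<in> W \<and> W \<subseteq> U"
    by blast
qed

lemma lukasiewicz_le_product:
  assumes "a \<in> {0..1}" "b \<in> {0..1}"
  shows "lukasiewicz_tnorm a b \<le> product_tnorm a b"
proof -
  have "0 \<le> (1 - a) * (1 - b)" "0 \<le> a * b"
    using assms by simp_all
  then show ?thesis
    by (simp add: lukasiewicz_tnorm_def product_tnorm_def algebra_simps)
qed

lemma product_le_goedel:
  assumes "a \<in> {0..1}" "b \<in> {0..1}"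
  shows "product_tnorm a b \<le> goedel_tnorm a b"
  using assms by (simp add: product_tnorm_def goedel_tnorm_def mult_left_le mult_left_le_one_le)

theorem theorem3p11:
  shows "{U. openin (open_ball_topology lukasiewicz_tnorm) U}
           \<subseteq> {U. openin (open_ball_topology product_tnorm) U}
       \<and> {U. openin (open_ball_topology product_tnorm) U}
           \<subseteq> {U. openin (open_ball_topology goedel_tnorm) U}"
  using open_ball_topology_mono[OF continuous_lukasiewicz continuous_product lukasiewicz_le_product]
    open_ball_topology_mono[OF continuous_product continuous_goedel product_le_goedel]
  by blast

end
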